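(* For all $t\in(0,\pi/2)$, $$\frac{\pi^2}{4e}\left(\frac{\sin t}{t}\right)^2<\left(\frac{\sin t}{t}\right)^{1/(\ln\pi-\ln2)}<\left(\cos\frac t2\right)^{2/\ln2}<e^{t\cot t-1}<\left(\cos\frac t2\right)^{8/3}<\left(\frac{\sin t}{t}\right)^2<\frac{2^{10/3}}{\pi^2}\left(\cos\frac t2\right)^{8/3},$$ $$\frac{\sin t}{t}<\frac23+\frac13\cos t<\frac{e^{t\cot t-1}+1}{2},$$ $$e^{t\cot t-1}>\frac23\cos t+\frac13>\frac{\frac{\sin t}{t}+\cos t}{2}.$$ *)

theory Defs
  imports "HOL-Analysis.Analysis"
begin

end

theory Submission
  imports Defs "HOL-Real_Asymp.Real_Asymp"
begin

text \<open>
  After taking logarithms, the claims compare \<open>ln (sin t / t)\<close>, \<open>ln (cos (t / 2))\<close>,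
  \<open>t cot t - 1\<close> and \<open>ln ((1 + 2 cos t) / 3)\<close>, all of which tend to \<open>0\<close> as \<open>t\<close> tends to \<open>0\<close>.
  Most of the functions to be compared have a monotone difference, because after clearing
  denominators its derivative becomes one of \<open>sin t - t cos t\<close>, \<open>t (2 + cos t) - 3 sin t\<close>,
  \<open>(2 + cos t) sin t - t (1 + 2 cos t)\<close> and \<open>3 t - (4 - cos t) sin t\<close>, all positive.
  In the two comparisons involving the constant \<open>2 / ln 2\<close> the difference vanishes at both \<open>0\<close>
  and \<open>\<pi> / 2\<close>; its derivative is a positive multiple of a function that starts at \<open>0\<close> and whose
  own derivative is a positive multiple of a strictly increasing function, so the difference first
  decreases and then increases.
\<close>

section \<open>Mean value and sign criteria with one-sided limits at the endpoints\<close>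

lemma mvt_limits:
  fixes f f' :: "real \<Rightarrow> real"
  assumes "a < b" "(f \<longlongrightarrow> l) (at_right a)" "(f \<longlongrightarrow> m) (at_left b)"
    and "\<And>x. a < x \<Longrightarrow> x < b \<Longrightarrow> (f has_real_derivative f' x) (at x)"
  obtains z where "a < z" "z < b" "m - l = (b - a) * f' z"
proof -
  \<comment> \<open>Replacing the endpoint values by the limits makes the function continuous on the
    closed interval. The values of \<open>f\<close> itself there may be wrong:
    \<open>x * cot x - 1\<close> is \<open>-1\<close> at \<open>0\<close>, but its limit is
    \<open>0\<close>.\<close>
  define g where "g = f(a := l, b := m)"
  have ga: "g a = l" and gb: "g b = m" and gx: "\<And>x. a < x \<Longrightarrow> x < b \<Longrightarrow> g x = f x"
    using assms(1) by (auto simp: g_def)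
  have ev: "\<forall>\<^sub>F y in nhds x. g y = f y" if "a < x" "x < b" for x
    using eventually_nhds_in_open[of "{a<..<b}" x] that gx by (auto elim: eventually_mono)
  have der: "(g has_real_derivative f' x) (at x)" if "a < x" "x < b" for x
    using DERIV_cong_ev[OF refl ev[OF that] refl] assms(4)[OF that] by simp
  have "(g \<longlongrightarrow> g a) (at_right a)"
    unfolding ga using assms(2)
    by (rule Lim_transform_eventually)
      (use assms(1) gx in \<open>auto simp: eventually_at_right[OF assms(1)]\<close>)
  moreover have "(g \<longlongrightarrow> g b) (at_left b)"
    unfolding gb using assms(3)
    by (rule Lim_transform_eventually)
      (use assms(1) gx in \<open>auto simp: eventually_at_left[OF assms(1)]\<close>)
  moreover have "g \<midarrow>x\<rightarrow> g x" if "a < x" "x < b" for x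
    using DERIV_isCont[OF der[OF that]] by (simp add: isCont_def)
  ultimately have cont: "continuous_on {a..b} g"
    using assms(1) by (intro continuous_on_IccI)
  have d: "(g has_derivative (\<lambda>y. f' x * y)) (at x)" if "a < x" "x < b" for x
    using der[OF that] by (simp add: has_field_derivative_def)
  obtain z where "a < z" "z < b" "g b - g a = f' z * (b - a)"
    by (rule mvt[OF assms(1) cont d])
  then show thesis by (intro that[of z]) (simp_all add: ga gb)
qed

lemma tendsto_at_within_if_DERIV:
  fixes f :: "real \<Rightarrow> real"
  assumes "(f has_real_derivative D) (at x)"
  shows "(f \<longlongrightarrow> f x) (at x within S)"
  using DERIV_isCont[OF assms] by (meson continuous_at_imp_continuous_at_within continuous_within)

text \<open>Suited to a singularity at \<open>a\<close> only: differentiability at \<open>b\<close>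
  supplies the left-hand limit \<open>f b\<close>, so no second limit has to be given.\<close>

lemma at_right_limit_less:
  fixes f f' :: "real \<Rightarrow> real"
  assumes "a < b" "(f \<longlongrightarrow> l) (at_right a)"
    and der: "\<And>x. a < x \<Longrightarrow> x \<le> b \<Longrightarrow> (f has_real_derivative f' x) (at x)"
    and pos: "\<And>x. a < x \<Longrightarrow> x < b \<Longrightarrow> f' x > 0"
  shows "l < f b"
proof -
  obtain z where "a < z" "z < b" "f b - l = (b - a) * f' z"
    by (rule mvt_limits[OF assms(1,2) tendsto_at_within_if_DERIV[OF der[OF assms(1) order_refl]]
          der[OF _ less_imp_le]])
  moreover have "(b - a) * f' z > 0" using pos[of z] assms(1) calculation by simp
  ultimately show ?thesis by linarith
qed

lemma less_at_left_limit:
  fixes f f' :: "real \<Rightarrow> real"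
  assumes "a < b" "(f \<longlongrightarrow> m) (at_left b)"
    and der: "\<And>x. a \<le> x \<Longrightarrow> x < b \<Longrightarrow> (f has_real_derivative f' x) (at x)"
    and pos: "\<And>x. a < x \<Longrightarrow> x < b \<Longrightarrow> f' x > 0"
  shows "f a < m"
proof -
  obtain z where "a < z" "z < b" "m - f a = (b - a) * f' z"
    by (rule mvt_limits[OF assms(1) tendsto_at_within_if_DERIV[OF der[OF order_refl assms(1)]]
          assms(2) der[OF less_imp_le]])
  moreover have "(b - a) * f' z > 0" using pos[of z] assms(1) calculation by simp
  ultimately show ?thesis by linarith
qed

text \<open>Four mean values contradict \<open>f x \<ge> 0\<close>. Rising from \<open>0\<close> to
  \<open>f x\<close> gives \<open>y < x\<close> with \<open>q y \<ge> 0\<close>; returning to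
  \<open>0\<close> gives \<open>z > x\<close> with \<open>q z \<le> 0\<close>. As \<open>q\<close>
  starts at \<open>0\<close>, some \<open>u < y\<close> has \<open>w u \<ge> 0\<close>, and between
  \<open>y\<close> and \<open>z\<close> some \<open>v\<close> has \<open>w v \<le> 0\<close>,
  although \<open>w\<close> increases. The sign of \<open>w\<close> itself need not be
  known.\<close>

lemma negative_between_zeros:
  fixes f p q r w :: "real \<Rightarrow> real"
  assumes "a < b" "(f \<longlongrightarrow> 0) (at_right a)" "(f \<longlongrightarrow> 0) (at_left b)"
    and derf: "\<And>x. a < x \<Longrightarrow> x < b \<Longrightarrow> (f has_real_derivative p x * q x) (at x)"
    and p: "\<And>x. a < x \<Longrightarrow> x < b \<Longrightarrow> p x > 0"
    and q: "(q \<longlongrightarrow> 0) (at_right a)"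
    and derq: "\<And>x. a < x \<Longrightarrow> x < b \<Longrightarrow> (q has_real_derivative r x * w x) (at x)"
    and r: "\<And>x. a < x \<Longrightarrow> x < b \<Longrightarrow> r x > 0"
    and w: "\<And>x y. a < x \<Longrightarrow> x < y \<Longrightarrow> y < b \<Longrightarrow> w x < w y"
    and x: "a < x" "x < b"
  shows "f x < 0"
proof (rule ccontr)
  assume "\<not> f x < 0"
  then have fx: "f x \<ge> 0" by simp
  note lim_f = tendsto_at_within_if_DERIV[OF derf]
  note lim_q = tendsto_at_within_if_DERIV[OF derq]
  obtain y where y: "a < y" "y < x" "f x - 0 = (x - a) * (p y * q y)"
    by (rule mvt_limits[OF x(1) assms(2) lim_f[OF x] derf[OF _ less_trans[OF _ x(2)]]])
  obtain z where z: "x < z" "z < b" "0 - f x = (b - x) * (p z * q z)"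
    by (rule mvt_limits[OF x(2) lim_f[OF x] assms(3) derf[OF less_trans[OF x(1)]]])
  have "q y \<ge> 0" using y fx x p[of y] by (simp add: zero_le_mult_iff)
  have "(b - x) * (p z * q z) \<le> 0" using z fx by simp
  then have "q z \<le> 0" using z x p[of z] by (simp add: mult_le_0_iff)
  have yb: "y < b" and az: "a < z" and yz: "y < z" using x y z by auto
  obtain u where u: "a < u" "u < y" "q y - 0 = (y - a) * (r u * w u)"
    by (rule mvt_limits[OF y(1) q lim_q[OF y(1) yb] derq[OF _ less_trans[OF _ yb]]])
  obtain v where v: "y < v" "v < z" "q z - q y = (z - y) * (r v * w v)"
    by (rule mvt_limits[OF yz lim_q[OF y(1) yb] lim_q[OF az z(2)]
          derq[OF less_trans[OF y(1)] less_trans[OF _ z(2)]]])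
  have "w u \<ge> 0" using u \<open>q y \<ge> 0\<close> yb r[of u] by (simp add: zero_le_mult_iff)
  have "(z - y) * (r v * w v) \<le> 0" using v \<open>q y \<ge> 0\<close> \<open>q z \<le> 0\<close> by simp
  then have "w v \<le> 0" using v z y r[of v] by (simp add: mult_le_0_iff)
  then show False using w[of u v] u v z \<open>w u \<ge> 0\<close> by simp
qed

section \<open>Elementary trigonometric inequalities on (0, pi/2)\<close>

lemma sin_cos_pos:
  fixes t :: real
  assumes "0 < t" "t < pi / 2"
  shows "0 < sin t" "0 < cos t" "cos t < 1"
  using assms cos_monotone_0_pi[of 0 t] by (auto intro: sin_gt_zero cos_gt_zero)

lemma sin_less_self:
  fixes t :: real
  assumes "0 < t" "t < pi / 2"
  shows "sin t < t"
proof -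
  have "0 < t - sin t"
  proof (rule at_right_limit_less[OF assms(1)])
    show "((\<lambda>x::real. x - sin x) \<longlongrightarrow> 0) (at_right 0)" by real_asymp
    show "((\<lambda>x. x - sin x) has_real_derivative 1 - cos x) (at x)" for x :: real
      by (auto intro!: derivative_eq_intros)
  qed (use assms sin_cos_pos in auto)
  then show ?thesis by simp
qed

lemma self_times_cos_less_sin:
  fixes t :: real
  assumes "0 < t" "t < pi / 2"
  shows "t * cos t < sin t"
proof -
  have "0 < sin t - t * cos t"
  proof (rule at_right_limit_less[OF assms(1)])
    show "((\<lambda>x::real. sin x - x * cos x) \<longlongrightarrow> 0) (at_right 0)" by real_asymp
    show "((\<lambda>x. sin x - x * cos x) has_real_derivative x * sin x) (at x)" for x :: real
      by (auto intro!: derivative_eq_intros)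
  qed (use assms sin_cos_pos in auto)
  then show ?thesis by simp
qed

text \<open>Two differentiations lead to \<open>sin x - x * cos x\<close>, already known to be
  positive; the difference and its first derivative both vanish at \<open>0\<close>.\<close>

lemma three_sin_less:
  fixes t :: real
  assumes "0 < t" "t < pi / 2"
  shows "3 * sin t < t * (2 + cos t)"
proof -
  have *: "0 < 2 - 2 * cos x - x * sin x" if "0 < x" "x < pi / 2" for x :: real
  proof (rule at_right_limit_less[OF that(1)])
    show "((\<lambda>x::real. 2 - 2 * cos x - x * sin x) \<longlongrightarrow> 0) (at_right 0)" by real_asymp
    show "((\<lambda>x. 2 - 2 * cos x - x * sin x) has_real_derivative sin x - x * cos x) (at x)" for x :: real
      by (auto intro!: derivative_eq_intros)
  qed (use that self_times_cos_less_sin in auto)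
  have "0 < t * (2 + cos t) - 3 * sin t"
  proof (rule at_right_limit_less[OF assms(1)])
    show "((\<lambda>x::real. x * (2 + cos x) - 3 * sin x) \<longlongrightarrow> 0) (at_right 0)" by real_asymp
    show "((\<lambda>x. x * (2 + cos x) - 3 * sin x) has_real_derivative 2 - 2 * cos x - x * sin x) (at x)"
      for x :: real
      by (auto intro!: derivative_eq_intros)
  qed (use assms * in auto)
  then show ?thesis by simp
qed

text \<open>The Pythagorean identity factors the derivative of the difference as
  \<open>2 * sin x * (x - sin x)\<close>.\<close>

lemma self_times_less_sin_times:
  fixes t :: real
  assumes "0 < t" "t < pi / 2"
  shows "t * (1 + 2 * cos t) < sin t * (2 + cos t)"
proof -
  have "0 < sin t * (2 + cos t) - t * (1 + 2 * cos t)"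
  proof (rule at_right_limit_less[OF assms(1)])
    show "((\<lambda>x::real. sin x * (2 + cos x) - x * (1 + 2 * cos x)) \<longlongrightarrow> 0) (at_right 0)"
      by real_asymp
    show "((\<lambda>x. sin x * (2 + cos x) - x * (1 + 2 * cos x)) has_real_derivative
        2 * sin x * (x - sin x)) (at x)" for x :: real
      using sin_cos_squared_add[of x]
      by (auto intro!: derivative_eq_intros simp: algebra_simps power2_eq_square)
  qed (use assms sin_less_self sin_cos_pos in auto)
  then show ?thesis by simp
qed

text \<open>The derivative of the difference is twice a perfect square.\<close>

lemma sin_times_less_three_self:
  fixes t :: real
  assumes "0 < t" "t < pi / 2"
  shows "sin t * (4 - cos t) < 3 * t"
proof -
  have "0 < 3 * t - sin t * (4 - cos t)"
  proof (rule at_right_limit_less[OF assms(1)])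
    show "((\<lambda>x::real. 3 * x - sin x * (4 - cos x)) \<longlongrightarrow> 0) (at_right 0)" by real_asymp
    show "((\<lambda>x. 3 * x - sin x * (4 - cos x)) has_real_derivative 2 * (1 - cos x)^2) (at x)"
      for x :: real
      using sin_cos_squared_add[of x]
      by (auto intro!: derivative_eq_intros simp: algebra_simps power2_eq_square)
  qed (use assms sin_cos_pos in fastforce)+
  then show ?thesis by simp
qed

text \<open>By the double-angle formula the numerator of the derivative is \<open>u - sin u\<close>.
  This quotient serves as the increasing factor when \<open>ln (sin t / t)\<close> is compared with
  \<open>ln (cos (t / 2))\<close>.\<close>

lemma tan_half_over_self_strict_mono:
  fixes x y :: real
  assumes "0 < x" "x < y" "y < pi / 2"
  shows "tan (x / 2) / x < tan (y / 2) / y"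
proof (rule DERIV_pos_imp_increasing[OF assms(2)])
  fix u assume u: "x \<le> u" "u \<le> y"
  have c: "0 < cos (u / 2)" using assms u by (intro cos_gt_zero) auto
  have "sin u < u" using assms u by (intro sin_less_self) auto
  then have "2 * sin (u / 2) * cos (u / 2) < u" using sin_double[of "u / 2"] by simp
  then have "0 < (u - 2 * sin (u / 2) * cos (u / 2)) / (2 * u^2 * (cos (u / 2))^2)"
    using c assms u by simp
  moreover have "((\<lambda>x. tan (x / 2) / x) has_real_derivative
      (u - 2 * sin (u / 2) * cos (u / 2)) / (2 * u^2 * (cos (u / 2))^2)) (at u)"
    using c assms u
    by (auto intro!: derivative_eq_intros simp: tan_def field_simps power2_eq_square)
      (simp flip: distrib_left power2_eq_square)
  ultimately show "\<exists>d. ((\<lambda>x. tan (x / 2) / x) has_real_derivative d) (at u) \<and> d > 0"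
    by blast
qed

section \<open>Derivatives and endpoint limits of the functions compared\<close>

context
  fixes t :: real
  assumes t: "0 < t" "t < pi"
begin

text \<open>Eliminates the half angle, so that all derivatives below are rational in
  \<open>t\<close>, \<open>sin t\<close> and \<open>cos t\<close>.\<close>

lemma tan_half_eq: "tan (t / 2) = (1 - cos t) / sin t"
proof -
  have "sin t > 0" "cos (t / 2) > 0" using t by (auto intro: sin_gt_zero cos_gt_zero)
  moreover have "cos t = 1 - 2 * (sin (t / 2))^2" "sin t = 2 * sin (t / 2) * cos (t / 2)"
    using cos_double_sin[of "t / 2"] sin_double[of "t / 2"] by simp_all
  moreover have "sin (t / 2) > 0" using t by (intro sin_gt_zero) auto
  ultimately show ?thesis by (simp add: tan_def power2_eq_square)
qed

lemma DERIV_ln_cos_half: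
  "((\<lambda>x. ln (cos (x / 2))) has_real_derivative - (1 - cos t) / (2 * sin t)) (at t)"
proof -
  have "cos (t / 2) > 0" using t by (auto intro: cos_gt_zero)
  then have "((\<lambda>x. ln (cos (x / 2))) has_real_derivative - tan (t / 2) / 2) (at t)"
    by (auto intro!: derivative_eq_intros simp: tan_def)
  moreover have "- tan (t / 2) / 2 = - (1 - cos t) / (2 * sin t)"
    using sin_gt_zero[OF t] by (simp add: tan_half_eq field_simps)
  ultimately show ?thesis by simp
qed

lemma DERIV_ln_sin_over_self:
  "((\<lambda>x. ln (sin x / x)) has_real_derivative (t * cos t - sin t) / (t * sin t)) (at t)"
  using t sin_gt_zero[OF t]
  by (auto intro!: derivative_eq_intros simp: field_simps power2_eq_square)

lemma DERIV_self_times_cot: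
  "((\<lambda>x. x * cot x - 1) has_real_derivative (sin t * cos t - t) / (sin t)^2) (at t)"
proof -
  have "sin t > 0" using t by (rule sin_gt_zero)
  moreover have "- inverse ((sin t)^2) * t + cot t = (sin t * cos t - t) / (sin t)^2"
    using calculation by (simp add: cot_def field_simps power2_eq_square)
  ultimately show ?thesis by (auto intro!: derivative_eq_intros DERIV_cot)
qed

end

text \<open>The derivative facts hold up to \<open>pi\<close>, so \<open>pi / 2\<close> is an
  interior point and the limits are the values there; \<open>cos (pi / 4) = sqrt 2 / 2\<close> gives
  the first.\<close>

lemma at_left_half_pi:
  "((\<lambda>x. ln (cos (x / 2))) \<longlongrightarrow> - ln 2 / 2) (at_left (pi / 2))"
  "((\<lambda>x. ln (sin x / x)) \<longlongrightarrow> ln 2 - ln pi) (at_left (pi / 2))"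
  "((\<lambda>x. x * cot x - 1) \<longlongrightarrow> - 1) (at_left (pi / 2))"
  by (rule tendsto_eq_rhs[OF tendsto_at_within_if_DERIV[OF DERIV_ln_cos_half]]
      tendsto_eq_rhs[OF tendsto_at_within_if_DERIV[OF DERIV_ln_sin_over_self]]
      tendsto_eq_rhs[OF tendsto_at_within_if_DERIV[OF DERIV_self_times_cot]];
      simp add: cos_45 ln_div ln_sqrt cot_def)+

lemma at_right_zero:
  "((\<lambda>x. ln (cos (x / 2))) \<longlongrightarrow> 0) (at_right (0 :: real))"
  "((\<lambda>x. ln (sin x / x)) \<longlongrightarrow> 0) (at_right (0 :: real))"
  "((\<lambda>x. x * cot x - 1) \<longlongrightarrow> 0) (at_right (0 :: real))"
  unfolding cot_def by real_asymp+

section \<open>Comparisons of the logarithms on (0, pi/2)\<close>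

context
  fixes t :: real
  assumes t: "0 < t" "t < pi / 2"
begin

text \<open>\<open>sin t / t\<close> decreases to \<open>2 / pi\<close>; the proof negates the
  logarithm to obtain an increasing function.\<close>

lemma ln_sin_over_self_gt: "ln 2 - ln pi < ln (sin t / t)"
proof -
  have "- ln (sin t / t) < - (ln 2 - ln pi)"
  proof (rule less_at_left_limit[OF t(2) tendsto_minus[OF at_left_half_pi(2)]])
    show "((\<lambda>x. - ln (sin x / x)) has_real_derivative (sin x - x * cos x) / (x * sin x)) (at x)"
      if "t \<le> x" "x < pi / 2" for x
      by (rule DERIV_cong[OF DERIV_minus[OF DERIV_ln_sin_over_self]])
        (use that t sin_cos_pos(1)[of x] in \<open>simp_all add: field_simps\<close>)
    show "0 < (sin x - x * cos x) / (x * sin x)" if "t < x" "x < pi / 2" for x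
      using that t self_times_cos_less_sin[of x] sin_cos_pos(1)[of x] by simp
  qed
  then show ?thesis by simp
qed

text \<open>The factors \<open>1 / (ln pi - ln 2)\<close> and \<open>2 / ln 2\<close> scale both
  sides to tend to \<open>-1\<close> at \<open>pi / 2\<close>, so their difference vanishes at both
  ends.\<close>

lemma ln_sin_over_self_less_ln_cos_half:
  "ln (sin t / t) / (ln pi - ln 2) < 2 / ln 2 * ln (cos (t / 2))"
proof -
  define K :: real where "K = ln pi - ln 2"
  have K: "K > 0" using pi_gt3 by (simp add: K_def)
  have "ln (sin t / t) / K - 2 / ln 2 * ln (cos (t / 2)) < 0"
  proof (rule negative_between_zeros[OF _ _ _ _ _ _ _ _ _ t])
    show "((\<lambda>x. ln (sin x / x) / K - 2 / ln 2 * ln (cos (x / 2))) \<longlongrightarrow> 0) (at_right 0)"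
      by (rule tendsto_eq_rhs[OF tendsto_diff[OF tendsto_divide[OF at_right_zero(2) tendsto_const]
              tendsto_mult_left[OF at_right_zero(1)]]]) (use K in simp_all)
    show "((\<lambda>x. ln (sin x / x) / K - 2 / ln 2 * ln (cos (x / 2))) \<longlongrightarrow> 0) (at_left (pi / 2))"
      by (rule tendsto_eq_rhs[OF tendsto_diff[OF tendsto_divide[OF at_left_half_pi(2) tendsto_const]
              tendsto_mult_left[OF at_left_half_pi(1)]]]) (use K in \<open>simp_all add: K_def divide_simps\<close>)
    show "((\<lambda>x. ln (sin x / x) / K - 2 / ln 2 * ln (cos (x / 2))) has_real_derivative
        (1 / (x * sin x)) * ((x * cos x - sin x) / K + x * (1 - cos x) / ln 2)) (at x)"
      if "0 < x" "x < pi / 2" for x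
      by (rule DERIV_cong[OF DERIV_diff[OF DERIV_cdivide[OF DERIV_ln_sin_over_self]
              DERIV_cmult[OF DERIV_ln_cos_half]]])
        (use that K sin_cos_pos(1)[OF that] in \<open>simp_all add: field_simps\<close>)
    show "((\<lambda>x. (x * cos x - sin x) / K + x * (1 - cos x) / ln 2) \<longlongrightarrow> 0) (at_right 0)"
      using K by (auto intro!: tendsto_eq_intros)
    \<comment> \<open>Taking out \<open>x * sin x\<close> leaves
      \<open>tan (x / 2) / x / ln 2\<close> minus a constant, which is increasing.\<close>
    show "((\<lambda>x. (x * cos x - sin x) / K + x * (1 - cos x) / ln 2) has_real_derivative
        (x * sin x) * (tan (x / 2) / x / ln 2 - (1 / K - 1 / ln 2))) (at x)"
      if "0 < x" "x < pi / 2" for x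
    proof -
      have tan: "tan (x / 2) = (1 - cos x) / sin x"
        using that by (intro tan_half_eq) auto
      have "(x * sin x) * (tan (x / 2) / x / ln 2 - (1 / K - 1 / ln 2)) =
          (1 - cos x) / ln 2 - x * sin x * (1 / K - 1 / ln 2)"
        using that sin_cos_pos(1)[OF that] K unfolding tan by (simp add: field_simps)
      moreover have "((\<lambda>x. (x * cos x - sin x) / K + x * (1 - cos x) / ln 2) has_real_derivative
          (1 - cos x) / ln 2 - x * sin x * (1 / K - 1 / ln 2)) (at x)"
        using K by (auto intro!: derivative_eq_intros simp: field_simps)
      ultimately show ?thesis by (simp only:)
    qed
    show "tan (x / 2) / x / ln 2 - (1 / K - 1 / ln 2) < tan (y / 2) / y / ln 2 - (1 / K - 1 / ln 2)"
      if "0 < x" "x < y" "y < pi / 2" for x y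
      using divide_strict_right_mono[OF tan_half_over_self_strict_mono[OF that], of "ln 2"] by simp
  qed (use sin_cos_pos in auto)
  then show ?thesis by (simp add: K_def)
qed

text \<open>Again both sides tend to \<open>-1\<close> at \<open>pi / 2\<close>, so
  \<open>negative_between_zeros\<close> applies.\<close>

lemma ln_cos_half_less_self_times_cot:
  "2 / ln 2 * ln (cos (t / 2)) < t * cot t - 1"
proof -
  have "2 / ln 2 * ln (cos (t / 2)) - (t * cot t - 1) < 0"
  proof (rule negative_between_zeros[OF _ _ _ _ _ _ _ _ _ t])
    show "((\<lambda>x::real. 2 / ln 2 * ln (cos (x / 2)) - (x * cot x - 1)) \<longlongrightarrow> 0) (at_right 0)"
      by (rule tendsto_eq_rhs[OF tendsto_diff[OF tendsto_mult_left[OF at_right_zero(1)]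
              at_right_zero(3)]]) simp
    show "((\<lambda>x::real. 2 / ln 2 * ln (cos (x / 2)) - (x * cot x - 1)) \<longlongrightarrow> 0) (at_left (pi / 2))"
      by (rule tendsto_eq_rhs[OF tendsto_diff[OF tendsto_mult_left[OF at_left_half_pi(1)]
              at_left_half_pi(3)]]) simp
    show "((\<lambda>x. 2 / ln 2 * ln (cos (x / 2)) - (x * cot x - 1)) has_real_derivative
        (1 / (sin x)^2) * (x - sin x * cos x - sin x * (1 - cos x) / ln 2)) (at x)"
      if "0 < x" "x < pi / 2" for x
      by (rule DERIV_cong[OF DERIV_diff[OF DERIV_cmult[OF DERIV_ln_cos_half] DERIV_self_times_cot]])
        (use that sin_cos_pos(1)[OF that] in \<open>simp_all add: field_simps power2_eq_square\<close>)
    show "((\<lambda>x::real. x - sin x * cos x - sin x * (1 - cos x) / ln 2) \<longlongrightarrow> 0) (at_right 0)"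
      by (auto intro!: tendsto_eq_intros)
    \<comment> \<open>With \<open>sin^2 = 1 - cos^2\<close> every term contains
      \<open>1 - cos x\<close>; the cofactor is affine in \<open>cos x\<close>, with negative slope
      because \<open>ln 2 < 1\<close>.\<close>
    show "((\<lambda>x. x - sin x * cos x - sin x * (1 - cos x) / ln 2) has_real_derivative
        (1 - cos x) * (2 - 1 / ln 2 - 2 * (1 / ln 2 - 1) * cos x)) (at x)"
      if "0 < x" "x < pi / 2" for x
    proof -
      have s: "sin x * sin x = 1 - cos x * cos x"
        using sin_squared_eq[of x] by (simp add: power2_eq_square)
      show ?thesis
        by (auto intro!: derivative_eq_intros simp: field_simps) (use s in algebra)
    qed
    show "2 - 1 / ln 2 - 2 * (1 / ln 2 - 1) * cos x < 2 - 1 / ln 2 - 2 * (1 / ln 2 - 1) * cos y"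
      if "0 < x" "x < y" "y < pi / 2" for x y
    proof -
      have "cos y < cos x" using that by (intro cos_monotone_0_pi) auto
      moreover have "2 * (1 / ln 2 - 1) > (0::real)"
        using ln_2_less_1 by (simp add: field_simps)
      ultimately have "2 * (1 / ln 2 - 1) * cos y < 2 * (1 / ln 2 - 1) * cos x"
        by (rule mult_strict_left_mono)
      then show ?thesis by simp
    qed
    show "0 < 1 / (sin x)^2" "0 < 1 - cos x" if "0 < x" "x < pi / 2" for x
      using sin_cos_pos[OF that] by simp_all
  qed simp
  then show ?thesis by simp
qed

lemma self_times_cot_less_ln_cos_half: "t * cot t - 1 < 8 / 3 * ln (cos (t / 2))"
proof -
  have "0 < 8 / 3 * ln (cos (t / 2)) - (t * cot t - 1)"
  proof (rule at_right_limit_less[OF t(1)])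
    show "((\<lambda>x::real. 8 / 3 * ln (cos (x / 2)) - (x * cot x - 1)) \<longlongrightarrow> 0) (at_right 0)"
      by (rule tendsto_eq_rhs[OF tendsto_diff[OF tendsto_mult_left[OF at_right_zero(1)]
              at_right_zero(3)]]) simp
    show "((\<lambda>x. 8 / 3 * ln (cos (x / 2)) - (x * cot x - 1)) has_real_derivative
        (3 * x - sin x * (4 - cos x)) / (3 * (sin x)^2)) (at x)" if "0 < x" "x \<le> t" for x
      by (rule DERIV_cong[OF DERIV_diff[OF DERIV_cmult[OF DERIV_ln_cos_half] DERIV_self_times_cot]])
        (use that t sin_cos_pos(1)[of x] in \<open>simp_all add: field_simps power2_eq_square\<close>)
    show "0 < (3 * x - sin x * (4 - cos x)) / (3 * (sin x)^2)" if "0 < x" "x < t" for x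
      using that t sin_times_less_three_self[of x] sin_cos_pos(1)[of x] by simp
  qed
  then show ?thesis by simp
qed

text \<open>This single increasing difference yields two bounds: its limit at \<open>0\<close>
  bounds it below, its limit at \<open>pi / 2\<close> above.\<close>

lemma DERIV_ln_sin_over_self_minus_ln_cos_half:
  "((\<lambda>x. 2 * ln (sin x / x) - 8 / 3 * ln (cos (x / 2))) has_real_derivative
    2 * (t * (2 + cos t) - 3 * sin t) / (3 * t * sin t)) (at t)"
  by (rule DERIV_cong[OF DERIV_diff[OF DERIV_cmult[OF DERIV_ln_sin_over_self]
          DERIV_cmult[OF DERIV_ln_cos_half]]])
    (use t sin_cos_pos(1)[OF t] in \<open>simp_all add: field_simps\<close>)

lemma DERIV_ln_sin_over_self_minus_ln_cos_half_pos:
  "0 < 2 * (t * (2 + cos t) - 3 * sin t) / (3 * t * sin t)"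
  using t sin_cos_pos(1)[OF t] three_sin_less[OF t] by simp

lemma exp_self_times_cot_gt: "2 / 3 * cos t + 1 / 3 < exp (t * cot t - 1)"
proof -
  have "0 < t * cot t - 1 - ln ((1 + 2 * cos t) / 3)"
  proof (rule at_right_limit_less[OF t(1)])
    show "((\<lambda>x::real. x * cot x - 1 - ln ((1 + 2 * cos x) / 3)) \<longlongrightarrow> 0) (at_right 0)"
      unfolding cot_def by real_asymp
    show "((\<lambda>x. x * cot x - 1 - ln ((1 + 2 * cos x) / 3)) has_real_derivative
        (sin x * (2 + cos x) - x * (1 + 2 * cos x)) / ((sin x)^2 * (1 + 2 * cos x))) (at x)"
      if "0 < x" "x \<le> t" for x
    proof -
      have pos: "sin x > 0" "1 + 2 * cos x > 0" using that t sin_cos_pos[of x] by auto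
      have "(sin x * cos x - x) / (sin x)^2 - (- 2 * sin x / (1 + 2 * cos x)) =
          ((sin x * cos x - x) * (1 + 2 * cos x) + 2 * sin x * (sin x)^2) /
          ((sin x)^2 * (1 + 2 * cos x))"
        using pos by (simp add: field_simps power2_eq_square)
      \<comment> \<open>Writing \<open>sin^2\<close> as \<open>1 - cos^2\<close> cancels the terms
        \<open>2 * sin x * (cos x)^2\<close>.\<close>
      also have "(sin x * cos x - x) * (1 + 2 * cos x) + 2 * sin x * (sin x)^2 =
          sin x * (2 + cos x) - x * (1 + 2 * cos x)"
        unfolding sin_squared_eq by (simp add: algebra_simps power2_eq_square)
      finally have eq: "(sin x * cos x - x) / (sin x)^2 - (- 2 * sin x / (1 + 2 * cos x)) =
          (sin x * (2 + cos x) - x * (1 + 2 * cos x)) / ((sin x)^2 * (1 + 2 * cos x))" .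
      have "((\<lambda>x. ln ((1 + 2 * cos x) / 3)) has_real_derivative - 2 * sin x / (1 + 2 * cos x)) (at x)"
        using pos by (auto intro!: derivative_eq_intros simp: field_simps)
      from DERIV_diff[OF DERIV_self_times_cot this] show ?thesis
        using that t eq by simp
    qed
    show "0 < (sin x * (2 + cos x) - x * (1 + 2 * cos x)) / ((sin x)^2 * (1 + 2 * cos x))"
      if "0 < x" "x < t" for x
      using that t self_times_less_sin_times[of x] sin_cos_pos[of x] by simp
  qed
  then have "exp (ln ((1 + 2 * cos t) / 3)) < exp (t * cot t - 1)" by simp
  then show ?thesis using sin_cos_pos(2)[OF t] by (simp add: field_simps)
qed

end

text \<open>Placed outside the context because the derivative facts for the fixed \<open>t\<close>
  are now needed at every intermediate point.\<close>

lemma ln_cos_half_less_ln_sin_over_self: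
  fixes t :: real
  assumes "0 < t" "t < pi / 2"
  shows "8 / 3 * ln (cos (t / 2)) < 2 * ln (sin t / t)"
proof -
  have "0 < 2 * ln (sin t / t) - 8 / 3 * ln (cos (t / 2))"
  proof (rule at_right_limit_less[OF assms(1)])
    show "((\<lambda>x::real. 2 * ln (sin x / x) - 8 / 3 * ln (cos (x / 2))) \<longlongrightarrow> 0) (at_right 0)"
      by (rule tendsto_eq_rhs[OF tendsto_diff[OF tendsto_mult_left[OF at_right_zero(2)]
              tendsto_mult_left[OF at_right_zero(1)]]]) simp
  qed (rule DERIV_ln_sin_over_self_minus_ln_cos_half
      DERIV_ln_sin_over_self_minus_ln_cos_half_pos; use assms in simp)+
  then show ?thesis by simp
qed

lemma ln_sin_over_self_less_ln_cos_half_plus: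
  fixes t :: real
  assumes "0 < t" "t < pi / 2"
  shows "2 * ln (sin t / t) < 10 / 3 * ln 2 - 2 * ln pi + 8 / 3 * ln (cos (t / 2))"
proof -
  \<comment> \<open>The right side is the limit at \<open>pi / 2\<close>; collecting
    \<open>2 * ln 2\<close> and \<open>4 / 3 * ln 2\<close> produces the constant
    \<open>10 / 3 * ln 2\<close>.\<close>
  have "2 * ln (sin t / t) - 8 / 3 * ln (cos (t / 2)) < 2 * (ln 2 - ln pi) - 8 / 3 * (- ln 2 / 2)"
  proof (rule less_at_left_limit[OF assms(2)])
    show "((\<lambda>x::real. 2 * ln (sin x / x) - 8 / 3 * ln (cos (x / 2))) \<longlongrightarrow>
        2 * (ln 2 - ln pi) - 8 / 3 * (- ln 2 / 2)) (at_left (pi / 2))"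
      by (intro tendsto_intros at_left_half_pi)
  qed (rule DERIV_ln_sin_over_self_minus_ln_cos_half
      DERIV_ln_sin_over_self_minus_ln_cos_half_pos; use assms in simp)+
  then show ?thesis by simp
qed

section \<open>A numerical bound and the assembly of the inequalities\<close>

lemma ln_pi_minus_ln_2_less_half: "ln pi - ln 2 < 1 / 2"
proof -
  have "pi < 3.2" using pi_approx by simp
  \<comment> \<open>The quadratic Taylor bound gives
    \<open>2 * (1 + 1/2 + 1/8) = 3.25\<close>.\<close>
  also have "3.2 < 2 * exp (1 / 2 :: real)"
    using exp_lower_Taylor_quadratic[of "1 / 2"] by (simp add: power2_eq_square)
  finally have "ln pi < ln (2 * exp (1 / 2))" by simp
  then show ?thesis by (simp add: ln_mult)
qed

theorem corollary4:
  fixes t :: real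
  assumes "t \<in> {0<..<pi / 2}"
  shows "(pi^2 / (4 * exp 1) * (sin t / t)^2 < (sin t / t) powr (1 / (ln pi - ln 2)))
    \<and> ((sin t / t) powr (1 / (ln pi - ln 2)) < cos (t / 2) powr (2 / ln 2))
    \<and> (cos (t / 2) powr (2 / ln 2) < exp (t * cot t - 1))
    \<and> (exp (t * cot t - 1) < cos (t / 2) powr (8 / 3))
    \<and> (cos (t / 2) powr (8 / 3) < (sin t / t)^2)
    \<and> ((sin t / t)^2 < 2 powr (10 / 3) / pi^2 * cos (t / 2) powr (8 / 3))
    \<and> (sin t / t < 2 / 3 + 1 / 3 * cos t)
    \<and> (2 / 3 + 1 / 3 * cos t < (exp (t * cot t - 1) + 1) / 2)
    \<and> (exp (t * cot t - 1) > 2 / 3 * cos t + 1 / 3)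
    \<and> (2 / 3 * cos t + 1 / 3 > (sin t / t + cos t) / 2)"
proof -
  have t: "0 < t" "t < pi / 2" using assms by auto
  define S where "S = ln (sin t / t)"
  define C where "C = ln (cos (t / 2))"
  define K :: real where "K = ln pi - ln 2"
  have pos: "sin t / t > 0" "cos (t / 2) > 0"
    using t sin_cos_pos(1)[OF t] by (auto intro: cos_gt_zero)
  \<comment> \<open>All powers and constants become exponentials in \<open>S\<close>,
    \<open>C\<close> and \<open>K\<close>, so only exponents remain to be compared.\<close>
  have S2: "(sin t / t)^2 = exp (2 * S)" using pos by (simp add: S_def exp_double)
  have Sp: "(sin t / t) powr a = exp (a * S)" for a using pos by (auto simp: powr_def S_def)
  have Cp: "cos (t / 2) powr a = exp (a * C)" for a using pos by (simp add: powr_def C_def)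
  have pi2: "exp (2 * ln pi) = pi^2" by (simp add: exp_double)
  have c1: "pi^2 / (4 * exp 1) = exp (2 * K - 1)"
    by (simp add: K_def right_diff_distrib exp_diff exp_double)
  have c2: "2 powr (10 / 3) / pi^2 = exp (10 / 3 * ln 2 - 2 * ln pi)"
    by (simp add: exp_diff pi2 powr_def)
  have K: "0 < K" "K < 1 / 2"
    using pi_gt3 ln_pi_minus_ln_2_less_half by (auto simp: K_def)
  \<comment> \<open>Divided by \<open>K\<close>, the expanded product is exactly the gap
    \<open>S / K - (2 * K - 1 + 2 * S)\<close> between the exponents. The factors are positive since
    \<open>sin t / t > 2 / pi\<close> and \<open>K < 1 / 2\<close>.\<close>
  have "(S + K) * (1 - 2 * K) > 0"
    using ln_sin_over_self_gt[OF t] K by (intro mult_pos_pos) (auto simp: S_def K_def)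
  then have "2 * K - 1 + 2 * S < 1 / K * S" using K by (simp add: field_simps)
  then have 1: "pi^2 / (4 * exp 1) * (sin t / t)^2 < (sin t / t) powr (1 / K)"
    by (simp only: c1 S2 Sp mult_exp_exp exp_less_cancel_iff)
  have 2: "(sin t / t) powr (1 / K) < cos (t / 2) powr (2 / ln 2)"
    using ln_sin_over_self_less_ln_cos_half[OF t] by (simp add: Sp Cp S_def C_def K_def)
  have 3: "cos (t / 2) powr (2 / ln 2) < exp (t * cot t - 1)"
    using ln_cos_half_less_self_times_cot[OF t] by (simp add: Cp C_def)
  have 4: "exp (t * cot t - 1) < cos (t / 2) powr (8 / 3)"
    using self_times_cot_less_ln_cos_half[OF t] by (simp add: Cp C_def)
  have 5: "cos (t / 2) powr (8 / 3) < (sin t / t)^2"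
    using ln_cos_half_less_ln_sin_over_self[OF t] unfolding Cp S2 by (simp add: S_def C_def)
  have 6: "(sin t / t)^2 < 2 powr (10 / 3) / pi^2 * cos (t / 2) powr (8 / 3)"
    using ln_sin_over_self_less_ln_cos_half_plus[OF t]
    unfolding Cp S2 c2 mult_exp_exp by (simp add: S_def C_def)
  have 7: "sin t / t < 2 / 3 + 1 / 3 * cos t"
    using three_sin_less[OF t] t by (simp add: field_simps)
  have 8: "exp (t * cot t - 1) > 2 / 3 * cos t + 1 / 3"
    by (rule exp_self_times_cot_gt[OF t])
  \<comment> \<open>This is the average of fact \<open>8\<close> with \<open>1\<close>; likewise
    fact \<open>10\<close> averages fact \<open>7\<close> with \<open>cos t\<close>.\<close>
  have 9: "2 / 3 + 1 / 3 * cos t < (exp (t * cot t - 1) + 1) / 2"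
    using 8 by argo
  have 10: "2 / 3 * cos t + 1 / 3 > (sin t / t + cos t) / 2"
    using 7 by argo
  show ?thesis
    by (intro conjI) (fact 1[unfolded K_def] 2[unfolded K_def] 3 4 5 6 7 8 9 10)+
qed

end
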